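(* Let $\mathbf{u}$ be a Parry word (simple or non-simple), i.e. the fixed point of a Parry substitution $\varphi$, and let $U_j=|\varphi^j(0)|$ for $j\ge 0$. If $\mathbf{u}$ is $c$-balanced for some $c>0$, then the sequence $\left(\rho^{\mathrm{ab}}_{\mathbf{u}}(n)\right)_{n=1}^{\infty}$ of values of the abelian complexity of $\mathbf{u}$ is $U$-automatic.
   Context: $\mathbb{N}=\{1,2,3,\dots\}$. For a finite word $w$, $|w|$ is its length and $|w|_\ell$ the number of occurrences of the letter $\ell$ in $w$. A factor of $\mathbf u$ is a finite block of consecutive letters of $\mathbf u$. Parry words. A simple Parry word over $\mathcal{A}=\{0,1,\dots,m-1\}$ ($m\ge 2$) is the fixed point $\mathbf{u}=u_0u_1u_2\cdots$ of the substitution $\varphi(\ell)=0^{\alpha_\ell}(\ell+1)$ for $0\le \ell\le m-2$, $\varphi(m-1)=0^{\alpha_{m-1}}$. A non-simple Parry word over $\mathcal{A}=\{0,1,\dots,m+p-1\}$ ($m,p\ge1$) is the fixed point $\mathbf{u}=u_0u_1u_2\cdots$ of $\varphi(\ell)=0^{\alpha_\ell}(\ell+1)$ for $0\le\ell\le m+p-2$, $\varphi(m+p-1)=0^{\alpha_{m+p-1}}m$. The $\alpha_\ell$ are non-negative integers with $\alpha_0\ge1$ and $\alpha_\ell\le\alpha_0$ for all $\ell\in\mathcal{A}$; in the simple case $\alpha_{m-1}\ge1$; in the non-simple case $\alpha_\ell\ge1$ for some $\ell\in\{m,\dots,m+p-1\}$. Moreover they satisfy Parry's condition: putting $t=\alpha_0\cdots\alpha_{m-1}0^\omega$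 (simple case) or $t=\alpha_0\cdots\alpha_{m-1}(\alpha_m\cdots\alpha_{m+p-1})^\omega$ (non-simple case), every shift $t_it_{i+1}t_{i+2}\cdots$ with $i\ge1$ is strictly lexicographically smaller than $t=t_0t_1t_2\cdots$. Normal $U$-representation. For $n\in\mathbb{N}$, $\langle n\rangle_U=d_kd_{k-1}\cdots d_0$ is the word of digits of the expansion $n=\sum_{j=0}^k d_jU_j$ obtained by the greedy algorithm ($U_k\le n<U_{k+1}$, so $d_k\neq0$); all digits lie in $\{0,1,\dots,\alpha_0\}$. $c$-balanced. An infinite word $\mathbf{u}$ over $\mathcal A$ is $c$-balanced if $\bigl||v|_\ell-|w|_\ell\bigr|\le c$ for every $\ell\in\mathcal{A}$ and all factors $v,w$ of $\mathbf{u}$ with $|v|=|w|$. Abelian complexity. $\Psi(w)=(|w|_\ell)_{\ell\in\mathcal{A}}$ is the Parikh vector of $w$, and $\rho^{\mathrm{ab}}_{\mathbf{u}}(n)=\#\{\Psi(w): w \text{ a factor of }\mathbf{u},\ |w|=n\}$. $U$-automatic. A deterministic finite automaton with output (DFAO) is a 6-tuple $(Q,\Sigma,\delta,q_0,\Delta,\tau)$ with $Q$ a finite set of states, $\Sigma$ a finite input alphabet, $\delta:Q\times\Sigma\to Q$, $q_0\in Q$, $\Delta$ a finite output alphabet and $\tau:Q\to\Delta$; $\delta$ is extended to $Q\times\Sigma^*$ by $\delta(q,\epsilon)=q$, $\delta(q,xa)=\delta(\delta(q,x),a)$. A sequence $(a_n)_{n\in\mathbb{N}}$ with values in a finite set $\Delta$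 is $U$-automatic if there is a DFAO with $\Sigma=\{0,1,\dots,\alpha_0\}$ such that $a_n=\tau(\delta(q_0,\langle n\rangle_U))$ for all $n\in\mathbb{N}$ (words are read from the most significant digit). *)

theory Defs
  imports Complex_Main "HOL-Library.Fun_Lexorder"
begin

text \<open>Finite words are lists of natural numbers, infinite words are functions on \<^typ>\<open>nat\<close>
  (indexed from 0). The alphabet of size \<open>d\<close> is \<open>{..<d}\<close>.\<close>

definition apply_subst :: "(nat \<Rightarrow> nat list) \<Rightarrow> nat list \<Rightarrow> nat list" where
  "apply_subst \<phi> w = concat (map \<phi> w)"

text \<open>\<^const>\<open>less_fun\<close> is the strict lexicographic order on infinite words.\<close>

definition parry_condition :: "(nat \<Rightarrow> nat) \<Rightarrow> bool" where
  "parry_condition t \<longleftrightarrow> (\<forall>i\<ge>1. less_fun (\<lambda>j. t (i + j)) t)"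

definition simple_parry_subst :: "nat \<Rightarrow> (nat \<Rightarrow> nat) \<Rightarrow> (nat \<Rightarrow> nat list) \<Rightarrow> bool" where
  "simple_parry_subst m \<alpha> \<phi> \<longleftrightarrow>
     m \<ge> 2 \<and> \<alpha> 0 \<ge> 1 \<and> (\<forall>l<m. \<alpha> l \<le> \<alpha> 0) \<and> \<alpha> (m - 1) \<ge> 1 \<and>
     parry_condition (\<lambda>i. if i < m then \<alpha> i else 0) \<and>
     (\<forall>l<m - 1. \<phi> l = replicate (\<alpha> l) 0 @ [l + 1]) \<and>
     \<phi> (m - 1) = replicate (\<alpha> (m - 1)) 0"

definition nonsimple_parry_subst ::
    "nat \<Rightarrow> nat \<Rightarrow> (nat \<Rightarrow> nat) \<Rightarrow> (nat \<Rightarrow> nat list) \<Rightarrow> bool" where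
  "nonsimple_parry_subst m p \<alpha> \<phi> \<longleftrightarrow>
     m \<ge> 1 \<and> p \<ge> 1 \<and> \<alpha> 0 \<ge> 1 \<and> (\<forall>l<m + p. \<alpha> l \<le> \<alpha> 0) \<and> (\<exists>l\<in>{m..<m + p}. \<alpha> l \<ge> 1) \<and>
     parry_condition (\<lambda>i. if i < m then \<alpha> i else \<alpha> (m + (i - m) mod p)) \<and>
     (\<forall>l<m + p - 1. \<phi> l = replicate (\<alpha> l) 0 @ [l + 1]) \<and>
     \<phi> (m + p - 1) = replicate (\<alpha> (m + p - 1)) 0 @ [m]"

text \<open>Only the values of \<open>\<alpha>\<close> and \<open>\<phi>\<close> on the alphabet \<open>{..<d}\<close> are constrained and used.\<close>

definition parry_subst :: "nat \<Rightarrow> (nat \<Rightarrow> nat) \<Rightarrow> (nat \<Rightarrow> nat list) \<Rightarrow> bool" where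
  "parry_subst d \<alpha> \<phi> \<longleftrightarrow>
     simple_parry_subst d \<alpha> \<phi> \<or> (\<exists>m p. d = m + p \<and> nonsimple_parry_subst m p \<alpha> \<phi>)"

text \<open>\<open>\<phi>(u) = u\<close>, i.e. the image of every prefix of \<open>u\<close> is a prefix of \<open>u\<close>. Parry substitutions
  map no letter to the empty word, so these images are arbitrarily long and determine \<open>\<phi>(u)\<close>.\<close>

definition fixed_point :: "nat \<Rightarrow> (nat \<Rightarrow> nat list) \<Rightarrow> (nat \<Rightarrow> nat) \<Rightarrow> bool" where
  "fixed_point d \<phi> u \<longleftrightarrow>
     range u \<subseteq> {..<d} \<and>
     (\<forall>n. \<exists>k. apply_subst \<phi> (map u [0..<n]) = map u [0..<k])"

definition factor :: "(nat \<Rightarrow> nat) \<Rightarrow> nat list \<Rightarrow> bool" where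
  "factor u w \<longleftrightarrow> (\<exists>i. w = map u [i..<i + length w])"

definition balanced :: "nat \<Rightarrow> real \<Rightarrow> (nat \<Rightarrow> nat) \<Rightarrow> bool" where
  "balanced d c u \<longleftrightarrow>
     (\<forall>l<d. \<forall>v w. factor u v \<and> factor u w \<and> length v = length w \<longrightarrow>
        \<bar>real (count_list v l) - real (count_list w l)\<bar> \<le> c)"

definition parikh :: "nat \<Rightarrow> nat list \<Rightarrow> nat list" where
  "parikh d w = map (count_list w) [0..<d]"

definition abelian_complexity :: "nat \<Rightarrow> (nat \<Rightarrow> nat) \<Rightarrow> nat \<Rightarrow> nat" where
  "abelian_complexity d u n = card {parikh d w |w. factor u w \<and> length w = n}"

text \<open>The greedy digits of \<open>n\<close> at the positions \<open>k - 1, \<dots>, 0\<close>, most significant digit first.\<close>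

primrec greedy_digits :: "(nat \<Rightarrow> nat) \<Rightarrow> nat \<Rightarrow> nat \<Rightarrow> nat list" where
  "greedy_digits U 0 n = []"
| "greedy_digits U (Suc k) n = (n div U k) # greedy_digits U k (n mod U k)"

text \<open>Meant for \<open>n \<ge> 1\<close> and strictly increasing \<open>U\<close> with \<open>U 0 = 1\<close>.\<close>

definition normal_rep :: "(nat \<Rightarrow> nat) \<Rightarrow> nat \<Rightarrow> nat list" where
  "normal_rep U n = greedy_digits U (Suc (THE k. U k \<le> n \<and> n < U (Suc k))) n"

record ('q, 'a, 'b) dfao =
  states :: "'q set"
  alphabet :: "'a set"
  trans :: "'q \<Rightarrow> 'a \<Rightarrow> 'q"
  init :: 'q
  outputs :: "'b set"
  out :: "'q \<Rightarrow> 'b"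

definition is_dfao :: "('q, 'a, 'b) dfao \<Rightarrow> bool" where
  "is_dfao M \<longleftrightarrow>
     finite (states M) \<and> finite (alphabet M) \<and> finite (outputs M) \<and>
     init M \<in> states M \<and>
     (\<forall>q\<in>states M. \<forall>a\<in>alphabet M. trans M q a \<in> states M) \<and>
     (\<forall>q\<in>states M. out M q \<in> outputs M)"

definition dfao_output :: "('q, 'a, 'b) dfao \<Rightarrow> 'a list \<Rightarrow> 'b" where
  "dfao_output M w = out M (foldl (trans M) (init M) w)"

text \<open>Automaticity over the digit alphabet \<open>{0..b}\<close> of a sequence indexed from 1. Taking the
  states to be natural numbers loses no generality, as the set of states is finite. The membership
  in \<open>lists\<close> ensures that the automaton only reads letters of its alphabet.\<close>

definition automatic :: "(nat \<Rightarrow> nat) \<Rightarrow> nat \<Rightarrow> (nat \<Rightarrow> 'b) \<Rightarrow> bool" where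
  "automatic U b a \<longleftrightarrow>
     (\<exists>M :: (nat, nat, 'b) dfao. is_dfao M \<and> alphabet M = {0..b} \<and>
        (\<forall>n\<ge>1. normal_rep U n \<in> lists (alphabet M) \<and> a n = dfao_output M (normal_rep U n)))"

end

theory Submission
  imports Defs "HOL-Library.Sublist"
begin

text \<open>
  Write \<open>\<Psi>\<^sub>i\<close> for the Parikh vector of the prefix of \<open>u\<close> of length \<open>i\<close>. The Parikh vectors of
  the factors of length \<open>n\<close> are the vectors \<open>\<Psi>\<^sub>j - \<Psi>\<^sub>i\<close> with \<open>j = i + n\<close>, and balancedness means that
  their displacements \<open>\<Psi>\<^sub>j - \<Psi>\<^sub>i - \<Psi>\<^sub>n\<close> lie in a fixed finite set. The automaton keeps track of more:
  after reading the digits of \<open>n\<close> its state is the set of all triples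
  \<open>(u\<^sub>i, u\<^sub>j, \<Psi>\<^sub>j - \<Psi>\<^sub>i - \<Psi>\<^sub>n)\<close> with \<open>\<bar>j - i - n\<bar> \<le> K\<close> (lemma \<open>next_state_neighbours\<close>). There are
  finitely many such sets, and \<open>\<rho>(n)\<close> is the number of third components with coordinate sum \<open>0\<close>
  (lemma \<open>abelian_complexity_eq\<close>).

  Reading a further digit \<open>a\<close> replaces the prefix of length \<open>n\<close> by its image under \<open>\<phi>\<close> followed by
  \<open>0\<^sup>a\<close>. Each position of \<open>u = \<phi>(u)\<close> lies in the image of a unique parent position, at an
  offset \<open>s\<close>, and the part of that image before the offset is \<open>0\<^sup>s\<close>. Hence a triple for the new \<open>n\<close>
  is computed from the triple of the parents by applying the incidence matrix of \<open>\<phi>\<close> and correcting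
  the coordinate of the letter \<open>0\<close>. It remains to see that the parents of a close pair are close
  (lemma \<open>close_parents\<close>). Since \<open>\<phi>\<close> lengthens the letter \<open>0\<close> and, by balancedness, every factor of
  some length \<open>N\<close> contains a \<open>0\<close>, the substitution expands distances by a factor of at least about
  \<open>1 + 1/N\<close>, up to an additive error. For large \<open>K\<close> the expansion absorbs the error.

  That greedy digits describe prefixes of \<open>u\<close> in this way (lemma \<open>greedy_admissible\<close>) is where
  Parry's condition enters. It makes \<open>\<phi>\<^sup>k(0)\<close> a longest one among the images \<open>\<phi>\<^sup>k(l)\<close> of letters, so
  that the greedy algorithm cuts \<open>\<phi>\<^sup>k\<^sup>+\<^sup>1(l) = \<phi>\<^sup>k(0) \<cdots> \<phi>\<^sup>k(0) \<phi>\<^sup>k(l+1)\<close> exactly at its block boundaries.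
\<close>

section \<open>Automata with arbitrary states\<close>

lemma automaticI:
  fixes T :: "'q \<Rightarrow> nat \<Rightarrow> 'q" and s :: "nat \<Rightarrow> 'b"
  assumes fin: "finite Q" and q0: "q0 \<in> Q"
    and closed: "\<And>q a. q \<in> Q \<Longrightarrow> a \<le> b \<Longrightarrow> T q a \<in> Q"
    and digits: "\<And>n. n \<ge> 1 \<Longrightarrow> set (normal_rep U n) \<subseteq> {..b}"
    and out: "\<And>n. n \<ge> 1 \<Longrightarrow> s n = h (foldl T q0 (normal_rep U n))"
  shows "automatic U b s"
proof -
  obtain e :: "'q \<Rightarrow> nat" where e: "inj_on e Q"
    using finite_imp_inj_to_nat_seg[OF fin] by blast
  define dec where "dec = inv_into Q e"
  have dec: "dec (e q) = q" if "q \<in> Q" for q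
    using e that by (simp add: dec_def)
  define M :: "(nat, nat, 'b) dfao" where
    "M = \<lparr>states = e ` Q, alphabet = {0..b}, trans = (\<lambda>q a. e (T (dec q) a)), init = e q0,
          outputs = h ` Q, out = (\<lambda>q. h (dec q))\<rparr>"
  have run: "foldl T q0 x \<in> Q \<and> foldl (trans M) (init M) x = e (foldl T q0 x)"
    if "set x \<subseteq> {..b}" for x
    using that
  proof (induction x rule: rev_induct)
    case Nil
    then show ?case using q0 by (simp add: M_def)
  next
    case (snoc a x)
    then show ?case using closed by (simp add: M_def dec)
  qed
  have "is_dfao M"
    using fin q0 closed dec by (auto simp: is_dfao_def M_def)
  moreover have "normal_rep U n \<in> lists (alphabet M) \<and> s n = dfao_output M (normal_rep U n)"
    if "n \<ge> 1" for n
    using digits[OF that] out[OF that] run[OF digits[OF that]] dec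
    by (auto simp: dfao_output_def M_def)
  moreover have "alphabet M = {0..b}" by (simp add: M_def)
  ultimately show ?thesis unfolding automatic_def by blast
qed

section \<open>Iterated substitutions\<close>

lemma apply_subst_Nil [simp]: "apply_subst \<phi> [] = []"
  and apply_subst_Cons [simp]: "apply_subst \<phi> (x # v) = \<phi> x @ apply_subst \<phi> v"
  and apply_subst_append [simp]: "apply_subst \<phi> (v @ v') = apply_subst \<phi> v @ apply_subst \<phi> v'"
  by (simp_all add: apply_subst_def)

lemma apply_subst_pow_append:
  "(apply_subst \<phi> ^^ k) (v @ v') = (apply_subst \<phi> ^^ k) v @ (apply_subst \<phi> ^^ k) v'"
  by (induction k) auto

lemma apply_subst_pow_replicate:
  "(apply_subst \<phi> ^^ k) (replicate n x) = concat (replicate n ((apply_subst \<phi> ^^ k) [x]))"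
proof (induction n)
  case 0
  show ?case by (induction k) auto
next
  case (Suc n)
  then show ?case using apply_subst_pow_append[of k \<phi> "[x]" "replicate n x"] by simp
qed

text \<open>The word \<open>\<phi>\<^sup>k\<^sup>-\<^sup>1(0\<^sup>d\<^sup>') \<cdots> \<phi>(0\<^sup>b) 0\<^sup>a\<close> of a digit sequence \<open>d' \<dots> b a\<close> of length \<open>k\<close>, in the form of
  Horner's scheme, which is the order in which an automaton reads the digits.\<close>

definition digit_word :: "(nat \<Rightarrow> nat list) \<Rightarrow> nat list \<Rightarrow> nat list" where
  "digit_word \<phi> = foldl (\<lambda>v a. apply_subst \<phi> v @ replicate a 0) []"

lemma digit_word_Nil [simp]: "digit_word \<phi> [] = []"
  and digit_word_snoc [simp]:
    "digit_word \<phi> (x @ [a]) = apply_subst \<phi> (digit_word \<phi> x) @ replicate a 0"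
  by (simp_all add: digit_word_def)

text \<open>The most significant digit, on which the greedy algorithm recurses, contributes a power of \<open>\<phi>\<^sup>k(0)\<close>.\<close>

lemma digit_word_Cons:
  "digit_word \<phi> (a # x) =
     concat (replicate a ((apply_subst \<phi> ^^ length x) [0])) @ digit_word \<phi> x"
proof (induction x rule: rev_induct)
  case Nil
  show ?case by (simp add: digit_word_def concat_replicate_trivial)
next
  case (snoc b x)
  have "digit_word \<phi> ((a # x) @ [b]) = apply_subst \<phi> (digit_word \<phi> (a # x)) @ replicate b 0"
    by (rule digit_word_snoc)
  then show ?case
    using snoc apply_subst_pow_replicate[of "Suc (length x)" \<phi> a 0]
      apply_subst_pow_replicate[of "length x" \<phi> a 0] by simp
qed

lemma length_greedy_digits [simp]: "length (greedy_digits U k n) = k"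
  by (induction k arbitrary: n) auto

lemma length_digit_word_greedy:
  assumes U: "\<And>j. U j = length ((apply_subst \<phi> ^^ j) [0])"
    and pos: "\<And>j. U j > 0"
  shows "n < U k \<Longrightarrow> length (digit_word \<phi> (greedy_digits U k n)) = n"
proof (induction k arbitrary: n)
  case 0
  then show ?case by (simp add: U)
next
  case (Suc k)
  have "length (digit_word \<phi> (greedy_digits U k (n mod U k))) = n mod U k"
    using Suc.IH pos by simp
  then show ?case
    by (simp add: digit_word_Cons length_concat sum_list_replicate U[symmetric])
qed

section \<open>Parry substitutions\<close>

text \<open>Simple and non-simple Parry substitutions are treated together: \<open>t\<close> is the infinite sequence of
  Parry's condition and \<open>w i\<close> is the letter that belongs to its \<open>i\<close>-th entry, or the empty word if
  \<open>i\<close> lies beyond the alphabet of a simple substitution. Both kinds then satisfy the uniform rule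
  \<open>w_step\<close>, without a special case for the last letter.\<close>

locale parry =
  fixes d :: nat and \<phi> :: "nat \<Rightarrow> nat list" and t :: "nat \<Rightarrow> nat" and w :: "nat \<Rightarrow> nat list"
  assumes parry: "parry_condition t"
    and w_letter: "l < d \<Longrightarrow> w l = [l]"
    and d_ge_2: "d \<ge> 2"
    and length_w: "length (w i) \<le> 1"
    and w_step: "apply_subst \<phi> (w i) = replicate (t i) 0 @ w (Suc i)"
    and w_empty: "w i = [] \<Longrightarrow> t j = 0 \<or> j < i"
    and nonerasing: "w i \<noteq> [] \<Longrightarrow> t i = 0 \<Longrightarrow> w (Suc i) \<noteq> []"
    and not_fixed: "l < d \<Longrightarrow> \<phi> l \<noteq> [l]"
    and t_0: "t 0 \<ge> 1"
    and t_nonzero: "\<exists>l\<ge>1. t l \<ge> 1"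
begin

definition A :: "nat \<Rightarrow> nat \<Rightarrow> nat list" where
  "A k i = (apply_subst \<phi> ^^ k) (w i)"

lemma A_0 [simp]: "A 0 i = w i"
  by (simp add: A_def)

lemma w_0: "w 0 = [0]" and w_1: "w 1 = [1]"
  using w_letter[of 0] w_letter[of 1] d_ge_2 by auto

lemma A_Suc: "A (Suc k) i = concat (replicate (t i) (A k 0)) @ A k (Suc i)"
  by (simp add: A_def funpow_Suc_right w_step apply_subst_pow_append apply_subst_pow_replicate w_0
      del: funpow.simps)

lemma length_A_Suc: "length (A (Suc k) i) = t i * length (A k 0) + length (A k (Suc i))"
  by (simp add: A_Suc length_concat sum_list_replicate)

lemma shift_less: "i \<ge> 1 \<Longrightarrow> less_fun (\<lambda>n. t (i + n)) t"
  using parry by (simp add: parry_condition_def)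

lemma t_le: "t i \<le> t 0"
proof (cases "i = 0")
  case False
  then have "less_fun (\<lambda>j. t (i + j)) t" using shift_less by simp
  then obtain k where "t (i + k) < t k" "\<forall>k'<k. t (i + k') = t k'"
    by (auto simp: less_fun_def)
  then show ?thesis by (cases k) (auto dest: spec[of _ 0])
qed simp

text \<open>A lexicographically smaller tail of \<open>t\<close> has images that are not longer. At the first entry where the two
  tails differ, the larger one offers a further block \<open>\<phi>\<^sup>k(0)\<close>, and by Parry's condition and
  induction this block is at least as long as everything that follows in the smaller one.\<close>

lemma length_A_mono:
  "less_fun (\<lambda>n. t (i + n)) (\<lambda>n. t (j + n)) \<Longrightarrow> length (A k i) \<le> length (A k j)"
proof (induction k arbitrary: i j)
  case 0
  then obtain n where "t (i + n) < t (j + n)" by (auto simp: less_fun_def)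
  then have "w j \<noteq> []" using w_empty[of j "j + n"] by auto
  then show ?case using length_w[of i] by (cases "w j") auto
next
  case (Suc k)
  then obtain n where n: "t (i + n) < t (j + n)" "\<forall>n'<n. t (i + n') = t (j + n')"
    by (auto simp: less_fun_def)
  have top: "length (A k (Suc i)) \<le> length (A k 0)"
    using Suc.IH[of "Suc i" 0] shift_less[of "Suc i"] by simp
  show ?case
  proof (cases n)
    case 0
    have "length (A (Suc k) i) \<le> Suc (t i) * length (A k 0)" using top by (simp add: length_A_Suc)
    also have "\<dots> \<le> t j * length (A k 0)" using n 0 by (intro mult_le_mono1) simp
    finally show ?thesis by (simp add: length_A_Suc)
  next
    case (Suc n')
    have "less_fun (\<lambda>n. t (Suc i + n)) (\<lambda>n. t (Suc j + n))"
      using n Suc by (auto simp: less_fun_def intro!: exI[of _ n'])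
    from Suc.IH[OF this] show ?thesis using n Suc by (auto simp: length_A_Suc dest: spec[of _ 0])
  qed
qed

lemma length_A_le: "length (A k i) \<le> length (A k 0)"
  using length_A_mono[of i 0 k] shift_less[of i] by (cases "i = 0") auto

lemma A_nonempty: "w i \<noteq> [] \<Longrightarrow> A k i \<noteq> []"
proof (induction k arbitrary: i)
  case (Suc k)
  then show ?case using nonerasing[of i] by (cases "t i = 0") (auto simp: A_Suc w_0)
qed simp

lemma length_A_strict: "length (A k 0) < length (A (Suc k) 0)"
proof -
  have "length (A k 0) \<le> t 0 * length (A k 0)" using t_0 by simp
  moreover have "A k (Suc 0) \<noteq> []" by (rule A_nonempty) (use w_1 in simp)
  ultimately show ?thesis unfolding length_A_Suc by (metis add_le_less_mono add.right_neutral length_greater_0_conv)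
qed

text \<open>Reading the images of all \<open>w i\<close> at once makes the induction work: the leading digit \<open>q\<close> of \<open>r\<close>
  skips \<open>q\<close> blocks \<open>\<phi>\<^sup>k(0)\<close>, and the rest of \<open>r\<close> points into one more such block or into the last
  block \<open>\<phi>\<^sup>k(w (i + 1))\<close>, which is not longer. The claim about initial segments of the digit list is
  needed because every intermediate state of the automaton has to describe a prefix of \<open>u\<close>.\<close>

lemma greedy_admissible:
  assumes U: "\<And>j. U j = length (A j 0)"
  shows "r < length (A k i) \<Longrightarrow> set (greedy_digits U k r) \<subseteq> {..t 0} \<and>
    (\<forall>j. prefix (digit_word \<phi> (take j (greedy_digits U k r))) (A (min j k) i))"
proof (induction k arbitrary: r i)
  case (Suc k)
  define q r' where "q = r div U k" and "r' = r mod U k"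
  have pos: "U k > 0" using A_nonempty[of 0 k] by (simp add: U w_0)
  have r: "r = q * U k + r'" by (simp add: q_def r'_def)
  have lt: "q * U k + r' < t i * U k + length (A k (Suc i))"
    using Suc.prems by (simp add: length_A_Suc r U)
  have le: "length (A k (Suc i)) \<le> U k" using length_A_le by (simp add: U)
  have "q * U k < Suc (t i) * U k" using lt le by simp
  then have q: "q \<le> t i" by (metis less_Suc_eq_le mult_less_cancel2)
  \<comment> \<open>the position in \<open>t\<close> of the letter in whose image \<open>r'\<close> points\<close>
  define i' where "i' = (if q < t i then 0 else Suc i)"
  have r': "r' < length (A k i')"
    using lt q pos by (auto simp: i'_def r'_def U)
  note IH = Suc.IH[OF r']
  have gd: "greedy_digits U (Suc k) r = q # greedy_digits U k r'"
    by (simp add: q_def r'_def)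
  have "prefix (digit_word \<phi> (take j (greedy_digits U (Suc k) r))) (A (min j (Suc k)) i)" for j
  proof (cases j)
    case (Suc j')
    define m where "m = min j' k"
    have pre: "prefix (digit_word \<phi> (take j' (greedy_digits U k r'))) (A m i')"
      using IH by (simp add: m_def)
    have eq: "digit_word \<phi> (take j (greedy_digits U (Suc k) r)) =
        concat (replicate q (A m 0)) @ digit_word \<phi> (take j' (greedy_digits U k r'))"
      unfolding gd Suc by (simp add: digit_word_Cons A_def w_0 m_def min.commute)
    have A: "A (min j (Suc k)) i = concat (replicate (t i) (A m 0)) @ A m (Suc i)"
      using A_Suc by (simp add: Suc m_def)
    show ?thesis
    proof (cases "q < t i")
      case True
      then obtain e where "t i = q + Suc e" by (metis add_Suc_right less_iff_Suc_add)
      then have e: "replicate (t i) (A m 0) = replicate q (A m 0) @ A m 0 # replicate e (A m 0)"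
        by (metis replicate_Suc replicate_add)
      show ?thesis using pre True unfolding eq A e by (auto simp: i'_def prefix_def)
    next
      case False
      then show ?thesis using pre q unfolding eq A by (auto simp: i'_def prefix_def)
    qed
  qed simp
  moreover have "set (greedy_digits U (Suc k) r) \<subseteq> {..t 0}"
    using IH q t_le[of i] unfolding gd by auto
  ultimately show ?case by blast
qed simp

text \<open>Some entry of \<open>t\<close> after the first is non-zero, so the images of \<open>1\<close> eventually contain \<open>0\<close>, and
  each application of \<open>\<phi>\<close> to \<open>\<phi>\<^sup>k(0)\<close> adds one of these images.\<close>

lemma zeros_in_A_unbounded: "\<exists>k. count_list (A k 0) 0 \<ge> n"
proof -
  define Z where "Z k i = count_list (A k i) 0" for k i
  have Z_Suc: "Z (Suc k) i = t i * Z k 0 + Z k (Suc i)" for k i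
  proof -
    have "count_list (concat (replicate q v)) x = q * count_list v x" for q v and x :: nat
      by (induction q) auto
    then show ?thesis by (simp add: Z_def A_Suc)
  qed
  have Z_0: "Z k 0 \<ge> 1" for k
  proof (induction k)
    case (Suc k)
    have "1 * 1 \<le> t 0 * Z k 0" using Suc t_0 by (intro mult_le_mono)
    then show ?case unfolding Z_Suc by linarith
  qed (simp add: Z_def w_0)
  obtain l where l: "l \<ge> 1" "t l \<ge> 1" using t_nonzero by blast
  have shift: "Z k (i + e) \<le> Z (k + e) i" for k i e
  proof (induction e arbitrary: i)
    case (Suc e)
    from Suc[of "Suc i"] show ?case by (simp add: Z_Suc)
  qed simp
  have Z_1: "Z (k + l) 1 \<ge> 1" for k
  proof -
    have "1 * 1 \<le> t l * Z k 0" using Z_0 l by (intro mult_le_mono)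
    then have "1 \<le> Z (Suc k) l" unfolding Z_Suc by linarith
    also have "\<dots> \<le> Z (Suc k + (l - 1)) 1" using shift[of "Suc k" 1 "l - 1"] l by simp
    finally show ?thesis using l by simp
  qed
  have "Z (n + l) 0 \<ge> n"
  proof (induction n)
    case (Suc n)
    have "1 * Z (n + l) 0 \<le> t 0 * Z (n + l) 0" using t_0 by (intro mult_le_mono1)
    moreover have "Z (Suc n + l) 0 = t 0 * Z (n + l) 0 + Z (n + l) 1" using Z_Suc[of "n + l" 0] by simp
    ultimately show ?case using Suc Z_1[of n] by linarith
  qed simp
  then show ?thesis unfolding Z_def by blast
qed

lemma image_letter: "l < d \<Longrightarrow> \<phi> l = replicate (t l) 0 @ w (Suc l)"
  using w_step[of l] by (simp add: w_letter)

lemma image_nonempty: "l < d \<Longrightarrow> \<phi> l \<noteq> []"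
  using nonerasing[of l] by (auto simp: image_letter w_letter)

lemma length_image_le: "l < d \<Longrightarrow> length (\<phi> l) \<le> t 0 + 1"
  using t_le[of l] length_w[of "Suc l"] by (simp add: image_letter)

lemma length_image_0: "length (\<phi> 0) \<ge> 2"
  using t_0 w_1 d_ge_2 by (simp add: image_letter)

text \<open>Proper prefixes of images of letters are powers of \<open>0\<close>, so an offset determines them.\<close>

lemma take_image: "l < d \<Longrightarrow> s < length (\<phi> l) \<Longrightarrow> take s (\<phi> l) = replicate s 0"
  using length_w[of "Suc l"] by (simp add: image_letter min_def)

end

section \<open>Parikh vectors of prefixes\<close>

lemma sum_count_list:
  fixes f :: "nat \<Rightarrow> nat"
  shows "set v \<subseteq> {..<d} \<Longrightarrow> (\<Sum>l<d. count_list v l * f l) = (\<Sum>x\<leftarrow>v. f x)"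
proof (induction v)
  case (Cons x v)
  have "(\<Sum>l<d. count_list (x # v) l * f l) =
      (\<Sum>l<d. (if l = x then f l else 0) + count_list v l * f l)"
    by (intro sum.cong) auto
  moreover have "(\<Sum>l<d. if l = x then f l else 0) = f x"
    using sum.delta[of "{..<d}" x f] Cons.prems by simp
  ultimately show ?case using Cons by (simp add: sum.distrib del: count_list.simps)
qed simp

lemma count_list_apply_subst: "count_list (apply_subst \<phi> v) l = (\<Sum>x\<leftarrow>v. count_list (\<phi> x) l)"
  by (induction v) auto

lemma length_apply_subst: "length (apply_subst \<phi> v) = (\<Sum>x\<leftarrow>v. length (\<phi> x))"
  by (induction v) auto

locale parry_word = parry +
  fixes u :: "nat \<Rightarrow> nat" and c :: nat
  assumes fixed: "fixed_point d \<phi> u"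
    and balanced: "balanced d (real c) u"
begin

definition P :: "nat \<Rightarrow> nat list" where
  "P n = map u [0..<n]"

text \<open>The image of the letter at position \<open>n\<close> of \<open>u\<close> starts at position \<open>g n\<close>.\<close>

definition g :: "nat \<Rightarrow> nat" where
  "g n = length (apply_subst \<phi> (P n))"

definition cnt :: "nat \<Rightarrow> nat \<Rightarrow> int" where
  "cnt n l = int (count_list (P n) l)"

lemma u_less: "u i < d"
  using fixed by (auto simp: fixed_point_def)

lemma P_0 [simp]: "P 0 = []" and P_Suc: "P (Suc n) = P n @ [u n]"
  by (simp_all add: P_def)

lemma length_P [simp]: "length (P n) = n"
  by (simp add: P_def)

lemma set_P: "set (P n) \<subseteq> {..<d}"
  using u_less by (auto simp: P_def)

lemma P_prefix: "prefix v (P n) \<longleftrightarrow> v = P (length v) \<and> length v \<le> n"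
proof
  assume "prefix v (P n)"
  then obtain z where z: "P n = v @ z" by (rule prefixE)
  have "n = length v + length z" using arg_cong[OF z, of length] by simp
  moreover have "v = take (length v) (P n)" by (simp add: z)
  ultimately show "v = P (length v) \<and> length v \<le> n" by (simp add: P_def take_map)
next
  assume "v = P (length v) \<and> length v \<le> n"
  then have "v = take (length v) (P n)" by (simp add: P_def take_map)
  then show "prefix v (P n)" by (metis take_is_prefix)
qed

lemma apply_P: "apply_subst \<phi> (P n) = P (g n)"
proof -
  obtain k where "apply_subst \<phi> (P n) = P k"
    using fixed by (auto simp: fixed_point_def P_def)
  then show ?thesis by (simp add: g_def)
qed

lemma g_0 [simp]: "g 0 = 0"
  by (simp add: g_def)

lemma g_Suc: "g (Suc n) = g n + length (\<phi> (u n))"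
  by (simp add: g_def P_Suc)

lemma P_g_add:
  assumes "s \<le> length (\<phi> (u i))"
  shows "P (g i + s) = P (g i) @ take s (\<phi> (u i))"
proof -
  have "P (g (Suc i)) = P (g i) @ \<phi> (u i)" by (simp flip: apply_P add: P_Suc)
  then have "prefix (P (g i) @ take s (\<phi> (u i))) (P (g (Suc i)))"
    by (simp add: take_is_prefix)
  then show ?thesis using assms by (simp add: P_prefix)
qed

lemma P_child:
  "s < length (\<phi> (u i)) \<Longrightarrow> P (g i + s) = apply_subst \<phi> (P i) @ replicate s 0"
  by (simp add: P_g_add take_image u_less apply_P)

lemma u_child:
  assumes "s < length (\<phi> (u i))"
  shows "u (g i + s) = \<phi> (u i) ! s"
proof -
  have "P (Suc (g i + s)) = P (g i) @ take (Suc s) (\<phi> (u i))"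
    using P_g_add[of "Suc s" i] assms by simp
  also have "\<dots> = P (g i + s) @ [\<phi> (u i) ! s]"
    using assms by (simp add: P_g_add take_Suc_conv_app_nth)
  finally show ?thesis by (simp add: P_Suc)
qed

lemma ex_parent: "\<exists>i s. n = g i + s \<and> s < length (\<phi> (u i))"
proof (induction n)
  case 0
  show ?case using image_nonempty[OF u_less] by (intro exI[of _ 0]) simp
next
  case (Suc n)
  then obtain i s where n: "n = g i + s" "s < length (\<phi> (u i))" by blast
  show ?case
  proof (cases "Suc s < length (\<phi> (u i))")
    case True
    then show ?thesis using n by (intro exI[of _ i] exI[of _ "Suc s"]) simp
  next
    case False
    then show ?thesis using n image_nonempty[OF u_less]
      by (intro exI[of _ "Suc i"] exI[of _ 0]) (simp add: g_Suc)
  qed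
qed

text \<open>The first letter \<open>l\<close> of \<open>u\<close> is the first letter of \<open>\<phi>(l)\<close>. If \<open>\<phi>(l)\<close> does not begin with \<open>0\<close>, then it is
  a single letter other than \<open>l\<close>.\<close>

lemma u_0: "u 0 = 0"
proof -
  have l: "u 0 < d" by (rule u_less)
  have nth: "\<phi> (u 0) ! 0 = u 0"
    using u_child[of 0 0] image_nonempty[OF l] by simp
  show ?thesis
  proof (cases "t (u 0)")
    case 0
    then have "\<phi> (u 0) = w (Suc (u 0))" using image_letter[OF l] by simp
    then have "\<phi> (u 0) = [u 0]"
      using nth image_nonempty[OF l] length_w[of "Suc (u 0)"] by (cases "w (Suc (u 0))") auto
    then show ?thesis using not_fixed[OF l] by simp
  next
    case (Suc n)
    then show ?thesis using nth by (simp add: image_letter[OF l])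
  qed
qed

lemma A_prefix: "A k 0 = P (length (A k 0))"
proof (induction k)
  case 0
  show ?case by (simp add: w_0 P_def u_0)
next
  case (Suc k)
  have "A (Suc k) 0 = apply_subst \<phi> (A k 0)" by (simp add: A_def)
  also have "\<dots> = P (g (length (A k 0)))" by (metis Suc apply_P)
  finally show ?case by simp
qed

lemma cnt_outside: "l \<ge> d \<Longrightarrow> cnt n l = 0"
  using set_P[of n] by (force simp: cnt_def count_list_0_iff)

lemma sum_cnt: "(\<Sum>l<d. cnt n l) = int n"
  using sum_count_list[OF set_P, of n "\<lambda>_. 1"] by (simp add: cnt_def sum_list_triv flip: of_nat_sum)

text \<open>The incidence matrix of \<open>\<phi>\<close>, applied to a vector.\<close>

definition img :: "(nat \<Rightarrow> int) \<Rightarrow> nat \<Rightarrow> int" where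
  "img D l = (\<Sum>k<d. D k * int (count_list (\<phi> k) l))"

lemma count_apply_subst:
  "int (count_list (apply_subst \<phi> (P n)) l) = img (cnt n) l"
  using sum_count_list[OF set_P, of n "\<lambda>k. count_list (\<phi> k) l"]
  by (simp add: img_def cnt_def count_list_apply_subst flip: of_nat_sum of_nat_mult)

lemma sum_img_cnt: "(\<Sum>k<d. cnt n k * int (length (\<phi> k))) = int (g n)"
  using sum_count_list[OF set_P, of n "\<lambda>k. length (\<phi> k)"]
  by (simp add: g_def cnt_def length_apply_subst flip: of_nat_sum of_nat_mult)

lemma cnt_image:
  "P n' = apply_subst \<phi> (P n) @ replicate a 0 \<Longrightarrow>
     cnt n' l = img (cnt n) l + (if l = 0 then int a else 0)"
proof -
  assume "P n' = apply_subst \<phi> (P n) @ replicate a 0"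
  moreover have "count_list (replicate a x) l = (if l = x then a else 0)" for x
    by (induction a) auto
  ultimately show ?thesis by (simp add: cnt_def[of n'] count_apply_subst)
qed

lemma factor_count:
  "int (count_list (map u [i..<i + n]) l) = cnt (i + n) l - cnt i l"
proof -
  have "[0..<i + n] = [0..<i] @ [i..<i + n]" using upt_add_eq_append[of 0 i n] by simp
  then show ?thesis by (simp add: cnt_def P_def)
qed

text \<open>Balancedness compares the factor of length \<open>n\<close> at position \<open>i\<close> with the prefix of length \<open>n\<close>.\<close>

lemma cnt_almost_additive:
  assumes "l < d"
  shows "\<bar>cnt (i + n) l - cnt i l - cnt n l\<bar> \<le> int c"
proof -
  have "factor u (map u [i..<i + n])" "factor u (map u [0..<0 + n])"
    unfolding factor_def by (metis add_diff_cancel_left' length_map length_upt)+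
  then have "\<bar>real (count_list (map u [i..<i + n]) l) - real (count_list (map u [0..<0 + n]) l)\<bar>
      \<le> real c"
    using balanced assms unfolding balanced_def by (metis add_diff_cancel_left' length_map length_upt)
  then have "\<bar>int (count_list (map u [i..<i + n]) l) - int (count_list (map u [0..<0 + n]) l)\<bar> \<le> int c"
    by linarith
  then show ?thesis unfolding factor_count by (simp add: cnt_def)
qed

section \<open>Close pairs have close parents\<close>

lemma cnt_diff: "0 \<le> cnt (i + m) l - cnt i l" "cnt (i + m) l - cnt i l \<le> int m"
  using count_le_length[of "map u [i..<i + m]" l] by (simp_all flip: factor_count)

text \<open>A prefix with at least \<open>c + 1\<close> zeros forces a zero into every factor of the same length, because \<open>u\<close>
  is \<open>c\<close>-balanced.\<close>

lemma zeros_dense: "\<exists>N. \<forall>i. cnt (i + N) 0 - cnt i 0 \<ge> 1"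
proof -
  obtain k where k: "count_list (A k 0) 0 \<ge> c + 1" using zeros_in_A_unbounded by blast
  define N where "N = length (A k 0)"
  have "cnt N 0 \<ge> int c + 1" using k A_prefix[of k] by (simp add: N_def cnt_def)
  moreover have "\<bar>cnt (i + N) 0 - cnt i 0 - cnt N 0\<bar> \<le> int c" for i
    using cnt_almost_additive d_ge_2 by simp
  ultimately have "cnt (i + N) 0 - cnt i 0 \<ge> 1" for i by (smt (verit))
  then show ?thesis by blast
qed

lemma zeros_lower_bound:
  assumes "\<forall>i. cnt (i + N) 0 - cnt i 0 \<ge> 1"
  shows "cnt (i + m) 0 - cnt i 0 \<ge> int (m div N)"
proof -
  have *: "cnt (i + q * N) 0 - cnt i 0 \<ge> int q" for q
  proof (induction q)
    case (Suc q)
    have "cnt (i + q * N + N) 0 - cnt (i + q * N) 0 \<ge> 1" using assms by blast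
    then show ?case using Suc by (simp add: algebra_simps)
  qed simp
  have "i + m = (i + m div N * N) + m mod N" by simp
  then have "cnt (i + m) 0 - cnt (i + m div N * N) 0 \<ge> 0" by (metis cnt_diff(1))
  then show ?thesis using *[of "m div N"] by linarith
qed

text \<open>Every letter contributes at least one letter to the image, and every \<open>0\<close> at least two.\<close>

lemma g_expanding:
  assumes "\<forall>i. cnt (i + N) 0 - cnt i 0 \<ge> 1"
  shows "int (g (i + m)) - int (g i) \<ge> int (m + m div N)"
proof -
  define E where "E k = cnt (i + m) k - cnt i k" for k
  have "(\<Sum>k<d. E k) + E 0 = (\<Sum>k<d. E k + (if k = 0 then E k else 0))"
    using d_ge_2 by (simp add: sum.distrib)
  also have "\<dots> \<le> (\<Sum>k<d. E k * int (length (\<phi> k)))"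
  proof (rule sum_mono)
    fix k assume "k \<in> {..<d}"
    then have "1 + (if k = 0 then 1 else 0) \<le> length (\<phi> k)"
      using image_nonempty[of k] length_image_0 by (cases "\<phi> k") auto
    then have "E k * int (1 + (if k = 0 then 1 else 0)) \<le> E k * int (length (\<phi> k))"
      using cnt_diff(1) unfolding E_def by (intro mult_left_mono) (simp_all only: of_nat_le_iff)
    then show "E k + (if k = 0 then E k else 0) \<le> E k * int (length (\<phi> k))"
      by (auto simp: algebra_simps split: if_splits)
  qed
  also have "\<dots> = int (g (i + m)) - int (g i)"
    by (simp add: E_def left_diff_distrib sum_subtractf sum_img_cnt)
  finally have "(\<Sum>k<d. E k) + E 0 \<le> int (g (i + m)) - int (g i)" .
  moreover have "(\<Sum>k<d. E k) = int m" by (simp add: E_def sum_subtractf sum_cnt)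
  moreover have "E 0 \<ge> int (m div N)" using zeros_lower_bound[OF assms] by (simp add: E_def)
  ultimately show ?thesis by simp
qed

lemma g_almost_additive:
  "\<bar>int (g (i + n)) - int (g i) - int (g n)\<bar> \<le> int (d * c * (t 0 + 1))"
proof -
  define E where "E k = cnt (i + n) k - cnt i k - cnt n k" for k
  have "int (g (i + n)) - int (g i) - int (g n) = (\<Sum>k<d. E k * int (length (\<phi> k)))"
    by (simp add: E_def left_diff_distrib sum_subtractf sum_img_cnt)
  also have "\<bar>\<dots>\<bar> \<le> (\<Sum>k<d. \<bar>E k * int (length (\<phi> k))\<bar>)" by (rule sum_abs)
  also have "\<dots> \<le> (\<Sum>k<d. int c * int (t 0 + 1))"
  proof (rule sum_mono)
    fix k assume "k \<in> {..<d}"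
    then have "\<bar>E k\<bar> \<le> int c" "int (length (\<phi> k)) \<le> int (t 0 + 1)"
      using cnt_almost_additive length_image_le unfolding E_def of_nat_le_iff by blast+
    then show "\<bar>E k * int (length (\<phi> k))\<bar> \<le> int c * int (t 0 + 1)"
      unfolding abs_mult by (intro mult_mono) auto
  qed
  finally show ?thesis by (simp add: algebra_simps)
qed

text \<open>The first factor bounds the additive errors in \<open>close_parents\<close>. A distance above this multiple of
  \<open>N\<close> gains at least the first factor by expansion.\<close>

definition radius :: "nat \<Rightarrow> nat" where
  "radius N = (d * c * (t 0 + 1) + 2 * (t 0 + 1)) * N"

text \<open>The distance \<open>m\<close> between \<open>j\<close> and \<open>i + n\<close> expands to at least \<open>m + m div N\<close> between \<open>g j\<close> and
  \<open>g (i + n)\<close>. The distance of the children differs from the latter by a bounded amount: the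
  failure of \<open>g\<close> to be additive, and the offsets and the digit.\<close>

lemma close_parents:
  assumes N: "\<forall>i. cnt (i + N) 0 - cnt i 0 \<ge> 1"
    and s: "s < length (\<phi> (u i))" "s' < length (\<phi> (u j))" "a \<le> t 0"
    and close: "\<bar>int (g j + s') - int (g i + s) - int (g n + a)\<bar> \<le> int (radius N)"
  shows "\<bar>int j - int i - int n\<bar> \<le> int (radius N)"
proof -
  define C where "C = d * c * (t 0 + 1) + 2 * (t 0 + 1)"
  have K: "radius N = C * N" by (simp add: C_def radius_def)
  have "N > 0" using N by (cases N) auto
  have bound: "s \<le> t 0" "s' \<le> t 0"
    using s length_image_le[OF u_less, of i] length_image_le[OF u_less, of j] by linarith+
  have add: "\<bar>int (g (i + n)) - int (g i) - int (g n)\<bar> \<le> int C - 2 * int (t 0)"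
    using g_almost_additive[of i n] by (simp add: C_def)
  have near: "\<bar>int (g j) - int (g (i + n))\<bar> \<le> int (radius N + C)"
    using close add bound s(3) by linarith
  have small: "m \<le> radius N" if "int (m + m div N) \<le> int (radius N + C)" for m
  proof (rule ccontr)
    assume "\<not> m \<le> radius N"
    moreover from this have "C \<le> m div N"
      using div_le_mono[of "C * N" m N] \<open>N > 0\<close> by (simp add: K)
    ultimately show False using that by linarith
  qed
  show ?thesis
  proof (cases "i + n \<le> j")
    case True
    then obtain m where m: "j = i + n + m" using le_Suc_ex by blast
    have "int (m + m div N) \<le> int (radius N + C)"
      using near g_expanding[OF N, of m "i + n"] unfolding m by linarith
    then show ?thesis using small[of m] m by simp
  next
    case False
    then obtain m where m: "i + n = j + m" using le_Suc_ex[of j "i + n"] by auto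
    have "int (m + m div N) \<le> int (radius N + C)"
      using near g_expanding[OF N, of m j] unfolding m by linarith
    then show ?thesis using small[of m] m by linarith
  qed
qed

section \<open>The automaton\<close>

definition disp :: "nat \<Rightarrow> nat \<Rightarrow> nat \<Rightarrow> nat \<Rightarrow> int" where
  "disp i j n l = cnt j l - cnt i l - cnt n l"

text \<open>The states of the automaton. Pairs with \<open>j \<noteq> i + n\<close> are included because the parents of a pair at
  distance exactly \<open>n\<close> need not have the distance that belongs to the parent of \<open>n\<close>. Pairs with \<open>j < i\<close>
  are not excluded, as this order is not preserved when two children of one position are chosen.\<close>

definition neighbours :: "nat \<Rightarrow> nat \<Rightarrow> (nat \<times> nat \<times> (nat \<Rightarrow> int)) set" where
  "neighbours K n = {(u i, u j, disp i j n) |i j. \<bar>int j - int i - int n\<bar> \<le> int K}"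

definition box :: "nat \<Rightarrow> (nat \<times> nat \<times> (nat \<Rightarrow> int)) set" where
  "box K = {..<d} \<times> {..<d} \<times>
     {D. \<forall>l. (l \<in> {..<d} \<longrightarrow> D l \<in> {- int (K + c)..int (K + c)}) \<and> (l \<notin> {..<d} \<longrightarrow> D l = 0)}"

definition child :: "(nat \<Rightarrow> int) \<Rightarrow> nat \<Rightarrow> nat \<Rightarrow> nat \<Rightarrow> nat \<Rightarrow> int" where
  "child D s s' a l = img D l + (if l = 0 then int s' - int s - int a else 0)"

text \<open>The intersection with the finite set \<open>box K\<close> makes the transitions total on the subsets of \<open>box K\<close>;
  on the states that are reached it removes nothing, by \<open>neighbours_box\<close>.\<close>

definition next_state ::
    "nat \<Rightarrow> (nat \<times> nat \<times> (nat \<Rightarrow> int)) set \<Rightarrow> nat \<Rightarrow> (nat \<times> nat \<times> (nat \<Rightarrow> int)) set" where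
  "next_state K S a =
     {(\<phi> x ! s, \<phi> y ! s', child D s s' a) |x y D s s'.
        (x, y, D) \<in> S \<and> s < length (\<phi> x) \<and> s' < length (\<phi> y) \<and>
        \<bar>\<Sum>l<d. child D s s' a l\<bar> \<le> int K} \<inter> box K"

lemma finite_box: "finite (box K)"
  unfolding box_def by (intro finite_cartesian_product finite_set_of_finite_funs) auto

lemma sum_disp: "(\<Sum>l<d. disp i j n l) = int j - int i - int n"
  by (simp add: disp_def sum_subtractf sum_cnt)

lemma neighbours_box: "neighbours K n \<subseteq> box K"
proof -
  have "\<bar>disp i j n l\<bar> \<le> int (K + c)" if "l < d" "\<bar>int j - int i - int n\<bar> \<le> int K" for i j l
  proof -
    have "\<bar>cnt j l - cnt (i + n) l\<bar> \<le> \<bar>int j - int (i + n)\<bar>"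
    proof (cases "i + n \<le> j")
      case True
      then show ?thesis using cnt_diff[of "i + n" "j - (i + n)" l] by simp
    next
      case False
      then show ?thesis using cnt_diff[of j "i + n - j" l] by simp
    qed
    then show ?thesis using cnt_almost_additive[OF that(1), of i n] that(2)
      unfolding disp_def by linarith
  qed
  then have "disp i j n l \<in> {- int (K + c)..int (K + c)}"
    if "l < d" "\<bar>int j - int i - int n\<bar> \<le> int K" for i j l
    using that by (metis abs_le_iff atLeastAtMost_iff minus_le_iff)
  moreover have "disp i j n l = 0" if "\<not> l < d" for i j l
    using that by (simp add: disp_def cnt_outside)
  ultimately show ?thesis
    unfolding neighbours_def box_def using u_less by auto
qed

lemma disp_child:
  assumes "P n' = apply_subst \<phi> (P n) @ replicate a 0"
    and "s < length (\<phi> (u i))" "s' < length (\<phi> (u j))"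
  shows "disp (g i + s) (g j + s') n' = child (disp i j n) s s' a"
proof
  fix l
  have "img (disp i j n) l = img (cnt j) l - img (cnt i) l - img (cnt n) l"
    by (simp add: img_def disp_def left_diff_distrib sum_subtractf)
  then show "disp (g i + s) (g j + s') n' l = child (disp i j n) s s' a l"
    using cnt_image[OF assms(1)] cnt_image[OF P_child[OF assms(2)]] cnt_image[OF P_child[OF assms(3)]]
    by (simp add: disp_def child_def)
qed

lemma next_state_neighbours:
  assumes N: "\<forall>i. cnt (i + N) 0 - cnt i 0 \<ge> 1"
    and n': "P n' = apply_subst \<phi> (P n) @ replicate a 0" and a: "a \<le> t 0"
  shows "next_state (radius N) (neighbours (radius N) n) a = neighbours (radius N) n'"
    (is "?L = ?R")
proof
  have n'_eq: "n' = g n + a" using arg_cong[OF n', of length] by (simp add: g_def)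
  show "?R \<subseteq> ?L"
  proof
    fix e assume e: "e \<in> ?R"
    then obtain i' j' where e_eq: "e = (u i', u j', disp i' j' n')"
      and close: "\<bar>int j' - int i' - int n'\<bar> \<le> int (radius N)"
      by (auto simp: neighbours_def)
    obtain i s where i: "i' = g i + s" "s < length (\<phi> (u i))" using ex_parent by blast
    obtain j s' where j: "j' = g j + s'" "s' < length (\<phi> (u j))" using ex_parent by blast
    have "(u i, u j, disp i j n) \<in> neighbours (radius N) n"
      using close_parents[OF N i(2) j(2) a, of n] close i j n'_eq by (auto simp: neighbours_def)
    moreover have "e = (\<phi> (u i) ! s, \<phi> (u j) ! s', child (disp i j n) s s' a)"
      using e_eq i j disp_child[OF n' i(2) j(2)] u_child by simp
    moreover have "\<bar>\<Sum>l<d. child (disp i j n) s s' a l\<bar> \<le> int (radius N)"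
      using close unfolding disp_child[OF n' i(2) j(2), symmetric] sum_disp i j .
    ultimately show "e \<in> ?L"
      using i j e neighbours_box unfolding next_state_def by blast
  qed
  show "?L \<subseteq> ?R"
  proof
    fix e assume "e \<in> ?L"
    then obtain i j s s' where e: "e = (\<phi> (u i) ! s, \<phi> (u j) ! s', child (disp i j n) s s' a)"
      and s: "s < length (\<phi> (u i))" "s' < length (\<phi> (u j))"
      and close: "\<bar>\<Sum>l<d. child (disp i j n) s s' a l\<bar> \<le> int (radius N)"
      unfolding next_state_def neighbours_def by blast
    have "e = (u (g i + s), u (g j + s'), disp (g i + s) (g j + s') n')"
      using e s disp_child[OF n' s] u_child by simp
    moreover have "\<bar>int (g j + s') - int (g i + s) - int n'\<bar> \<le> int (radius N)"
      using close unfolding disp_child[OF n' s, symmetric] sum_disp .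
    ultimately show "e \<in> ?R" unfolding neighbours_def by blast
  qed
qed

lemma run_neighbours:
  assumes N: "\<forall>i. cnt (i + N) 0 - cnt i 0 \<ge> 1"
  shows "\<forall>j. \<exists>k. digit_word \<phi> (take j x) = P k \<Longrightarrow> set x \<subseteq> {..t 0} \<Longrightarrow>
    foldl (next_state (radius N)) (neighbours (radius N) 0) x =
      neighbours (radius N) (length (digit_word \<phi> x))"
proof (induction x rule: rev_induct)
  case (snoc a x)
  have prefixes: "\<exists>k. digit_word \<phi> (take j x) = P k" for j
    using snoc.prems(1)[rule_format, of "min j (length x)"] by (cases "j \<le> length x") auto
  obtain n where n: "digit_word \<phi> x = P n" using prefixes[of "length x"] by auto
  obtain n' where n': "digit_word \<phi> (x @ [a]) = P n'"
    using snoc.prems(1)[rule_format, of "Suc (length x)"] by auto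
  have "foldl (next_state (radius N)) (neighbours (radius N) 0) x = neighbours (radius N) n"
    using snoc.IH prefixes snoc.prems(2) n by simp
  moreover have "P n' = apply_subst \<phi> (P n) @ replicate a 0"
    using n n' by simp
  moreover have "length (digit_word \<phi> (x @ [a])) = n'"
    using n' by (simp only: length_P)
  ultimately show ?case
    using next_state_neighbours[OF N, of n' n a] snoc.prems(2) by (simp del: digit_word_snoc)
qed simp

definition zero_sum_count :: "(nat \<times> nat \<times> (nat \<Rightarrow> int)) set \<Rightarrow> nat" where
  "zero_sum_count S = card {D. \<exists>x y. (x, y, D) \<in> S \<and> (\<Sum>l<d. D l) = 0}"

text \<open>Subtracting the Parikh vector of the prefix of length \<open>n\<close> is injective, so it does not change the count.\<close>

lemma abelian_complexity_eq: "abelian_complexity d u n = zero_sum_count (neighbours K n)"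
proof -
  define F where "F p l = (if l < d then int (p ! l) else 0) - cnt n l" for p l
  have F: "F (parikh d (map u [i..<i + n])) = disp i (i + n) n" for i
    by (rule ext) (simp add: F_def parikh_def disp_def factor_count cnt_outside)
  have words: "{parikh d v |v. factor u v \<and> length v = n} = range (\<lambda>i. parikh d (map u [i..<i + n]))"
  proof -
    have "{v. factor u v \<and> length v = n} = range (\<lambda>i. map u [i..<i + n])"
      by (auto simp: factor_def)
    then have "parikh d ` {v. factor u v \<and> length v = n} =
        range (\<lambda>i. parikh d (map u [i..<i + n]))"
      by (simp only: image_image)
    then show ?thesis by (simp only: setcompr_eq_image)
  qed
  have D: "{D. \<exists>x y. (x, y, D) \<in> neighbours K n \<and> (\<Sum>l<d. D l) = 0} = range (\<lambda>i. disp i (i + n) n)"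
  proof -
    have "D \<in> range (\<lambda>i. disp i (i + n) n)"
      if mem: "(x, y, D) \<in> neighbours K n" and sum: "(\<Sum>l<d. D l) = 0" for x y D
    proof -
      obtain i j where D: "D = disp i j n" using mem by (auto simp: neighbours_def)
      then have "j = i + n" using sum by (simp add: sum_disp)
      then show ?thesis using D by blast
    qed
    moreover have "\<exists>x y. (x, y, disp i (i + n) n) \<in> neighbours K n" for i
      unfolding neighbours_def by force
    moreover have "(\<Sum>l<d. disp i (i + n) n l) = 0" for i by (simp add: sum_disp)
    ultimately show ?thesis by auto
  qed
  have "inj_on F (range (\<lambda>i. parikh d (map u [i..<i + n])))"
  proof (rule inj_onI)
    fix p q assume pq: "p \<in> range (\<lambda>i. parikh d (map u [i..<i + n]))"
      "q \<in> range (\<lambda>i. parikh d (map u [i..<i + n]))" "F p = F q"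
    show "p = q"
    proof (rule nth_equalityI)
      show "length p = length q" using pq by (auto simp: parikh_def)
      fix l assume "l < length p"
      then have "l < d" using pq by (auto simp: parikh_def)
      then show "p ! l = q ! l" using fun_cong[OF pq(3), of l] by (simp add: F_def)
    qed
  qed
  then have "card (F ` range (\<lambda>i. parikh d (map u [i..<i + n]))) = abelian_complexity d u n"
    unfolding abelian_complexity_def words by (rule card_image)
  moreover have "F ` range (\<lambda>i. parikh d (map u [i..<i + n])) = range (\<lambda>i. disp i (i + n) n)"
    unfolding image_image F ..
  ultimately show ?thesis unfolding zero_sum_count_def D by simp
qed

lemma automatic_abelian_complexity:
  assumes U: "\<And>j. U j = length ((apply_subst \<phi> ^^ j) [0])"
  shows "automatic U (t 0) (abelian_complexity d u)"
proof -
  obtain N where N: "\<forall>i. cnt (i + N) 0 - cnt i 0 \<ge> 1" using zeros_dense by blast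
  define K where "K = radius N"
  have U_A: "U j = length (A j 0)" for j by (simp add: U A_def w_0)
  have mono: "strict_mono U" unfolding strict_mono_Suc_iff U_A using length_A_strict by blast
  have U_0: "U 0 = 1" by (simp add: U)
  have U_pos: "U j > 0" for j using strict_mono_leD[OF mono, of 0 j] U_0 by simp
  have rep: "\<exists>k. normal_rep U n = greedy_digits U k n \<and> n < U k" if "n \<ge> 1" for n
  proof -
    define k where "k = (LEAST k. n < U k)"
    have "n < U (Suc n)" using strict_mono_imp_increasing[OF mono, of "Suc n"] by simp
    then have k: "n < U k" unfolding k_def by (rule LeastI)
    then have "k \<noteq> 0" using that U_0 by (cases k) auto
    then obtain k' where k': "k = Suc k'" by (cases k) auto
    have "\<not> n < U k'" using not_less_Least[of k' "\<lambda>k. n < U k"] k' by (simp add: k_def)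
    then have "(THE k. U k \<le> n \<and> n < U (Suc k)) = k'"
    proof (intro the_equality)
      fix l assume l: "U l \<le> n \<and> n < U (Suc l)"
      have "U l < U (Suc k')" using conjunct1[OF l] k k' by simp
      moreover have "U k' < U (Suc l)" using conjunct2[OF l] \<open>\<not> n < U k'\<close> by linarith
      ultimately show "l = k'" using strict_mono_less[OF mono] by simp
    qed (use k k' in simp)
    then show ?thesis using k k' unfolding normal_rep_def by metis
  qed
  have good: "set (normal_rep U n) \<subseteq> {..t 0}"
      "\<forall>j. \<exists>k. digit_word \<phi> (take j (normal_rep U n)) = P k"
      "length (digit_word \<phi> (normal_rep U n)) = n" if n: "n \<ge> 1" for n
  proof -
    obtain k where k: "normal_rep U n = greedy_digits U k n" "n < U k" using rep[OF n] by blast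
    note adm = greedy_admissible[of U n k 0, OF U_A k(2)[unfolded U_A]]
    show "set (normal_rep U n) \<subseteq> {..t 0}" using adm k by simp
    show "\<forall>j. \<exists>k. digit_word \<phi> (take j (normal_rep U n)) = P k"
      using adm k A_prefix P_prefix by metis
    show "length (digit_word \<phi> (normal_rep U n)) = n"
      using length_digit_word_greedy[OF U U_pos k(2)] k by simp
  qed
  show ?thesis
  proof (rule automaticI[where Q = "Pow (box K)" and T = "next_state K"
        and ?q0.0 = "neighbours K 0" and h = zero_sum_count])
    show "finite (Pow (box K))" using finite_box by simp
    show "neighbours K 0 \<in> Pow (box K)" using neighbours_box by blast
    show "next_state K q a \<in> Pow (box K)" for q a by (auto simp: next_state_def)
    show "set (normal_rep U n) \<subseteq> {..t 0}" if "n \<ge> 1" for n using good that by blast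
    show "abelian_complexity d u n =
        zero_sum_count (foldl (next_state K) (neighbours K 0) (normal_rep U n))" if "n \<ge> 1" for n
      using run_neighbours[OF N good(2,1)[OF that]] good(3)[OF that]
      by (simp add: K_def flip: abelian_complexity_eq)
  qed
qed

end

section \<open>Simple and non-simple Parry substitutions\<close>

lemma parry_simple:
  assumes "simple_parry_subst d \<alpha> \<phi>"
  shows "parry d \<phi> (\<lambda>i. if i < d then \<alpha> i else 0) (\<lambda>i. if i < d then [i] else [])"
proof -
  have d: "d \<ge> 2" and last: "\<alpha> (d - 1) \<ge> 1"
    using assms by (auto simp: simple_parry_subst_def)
  have phi: "\<phi> l = replicate (\<alpha> l) 0 @ (if Suc l < d then [Suc l] else [])" if "l < d" for l
    using assms that by (cases "l = d - 1") (auto simp: simple_parry_subst_def)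
  have zero: "Suc i < d" if "i < d" "\<alpha> i = 0" for i
    using that last by (cases "i = d - 1") auto
  have not_fixed: "\<phi> l \<noteq> [l]" if "l < d" for l
  proof
    assume "\<phi> l = [l]"
    then have eq: "replicate (\<alpha> l) 0 @ (if Suc l < d then [Suc l] else []) = [l]"
      using phi[OF that] by simp
    then show False
    proof (cases "Suc l < d")
      case True
      then show ?thesis using eq arg_cong[OF eq, of last] by simp
    next
      case False
      then have "replicate (\<alpha> l) 0 = [l]" using eq by simp
      then have "l \<in> set (replicate (\<alpha> l) 0)" by simp
      then have "l = 0" by (simp add: set_replicate_conv_if split: if_splits)
      then show ?thesis using False d by simp
    qed
  qed
  show ?thesis
  proof
    show "parry_condition (\<lambda>i. if i < d then \<alpha> i else 0)"
      using assms by (simp add: simple_parry_subst_def)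
    show "\<exists>l\<ge>1. (if l < d then \<alpha> l else 0) \<ge> 1"
      using last d by (intro exI[of _ "d - 1"]) auto
  qed (use assms d last phi zero not_fixed in \<open>auto simp: simple_parry_subst_def split: if_splits\<close>)
qed

lemma parry_nonsimple:
  assumes "nonsimple_parry_subst m p \<alpha> \<phi>"
  defines "st \<equiv> \<lambda>i. if i < m then i else m + (i - m) mod p"
  shows "parry (m + p) \<phi> (\<lambda>i. \<alpha> (st i)) (\<lambda>i. [st i])"
proof -
  have mp: "m \<ge> 1" "p \<ge> 1" "\<alpha> 0 \<ge> 1" using assms by (auto simp: nonsimple_parry_subst_def)
  obtain l0 where l0: "l0 \<in> {m..<m + p}" "\<alpha> l0 \<ge> 1"
    using assms by (auto simp: nonsimple_parry_subst_def)
  have st_id: "st l = l" if "l < m + p" for l using that by (auto simp: st_def)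
  have st_less: "st i < m + p" for i using mp by (simp add: st_def)
  have st_Suc: "st (Suc i) = (if st i = m + p - 1 then m else Suc (st i))" for i
    using mp by (auto simp: st_def Suc_diff_le mod_Suc)
  have phi: "\<phi> l = replicate (\<alpha> l) 0 @ [if l = m + p - 1 then m else Suc l]" if "l < m + p" for l
    using assms that by (auto simp: nonsimple_parry_subst_def)
  have t: "(\<lambda>i. \<alpha> (st i)) = (\<lambda>i. if i < m then \<alpha> i else \<alpha> (m + (i - m) mod p))"
    by (auto simp: st_def)
  show ?thesis
  proof
    show "parry_condition (\<lambda>i. \<alpha> (st i))"
      using assms unfolding t by (simp add: nonsimple_parry_subst_def)
    show "\<exists>l\<ge>1. \<alpha> (st l) \<ge> 1"
      using l0 mp st_id by (intro exI[of _ l0]) auto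
    show "\<phi> l \<noteq> [l]" if "l < m + p" for l
    proof
      assume "\<phi> l = [l]"
      then have eq: "replicate (\<alpha> l) 0 @ [if l = m + p - 1 then m else Suc l] = [l]"
        using phi[OF that] by simp
      have "\<alpha> l = 0" using arg_cong[OF eq, of length] by simp
      then have "(if l = m + p - 1 then m else Suc l) = l" using eq by simp
      then have "l = m + p - 1" "l = m" by (metis n_not_Suc_n)+
      then have "l0 = l" using l0 by auto
      then show False using l0 \<open>\<alpha> l = 0\<close> by simp
    qed
    show "apply_subst \<phi> [st i] = replicate (\<alpha> (st i)) 0 @ [st (Suc i)]" for i
      using phi[OF st_less] st_Suc by simp
    show "1 \<le> \<alpha> (st 0)" using mp by (simp add: st_def)
  qed (use mp st_id in auto)
qed

theorem mainTheorem1: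
  fixes d :: nat and \<alpha> :: "nat \<Rightarrow> nat" and \<phi> :: "nat \<Rightarrow> nat list"
    and u :: "nat \<Rightarrow> nat" and U :: "nat \<Rightarrow> nat" and c :: real
  assumes "parry_subst d \<alpha> \<phi>"
    and "fixed_point d \<phi> u"
    and "\<And>j. U j = length ((apply_subst \<phi> ^^ j) [0])"
    and "c > 0"
    and "balanced d c u"
  shows "automatic U (\<alpha> 0) (abelian_complexity d u)"
proof -
  obtain t w where parry: "parry d \<phi> t w" and t_alpha: "t 0 = \<alpha> 0"
    using assms(1) unfolding parry_subst_def
  proof (elim disjE exE conjE)
    assume simple: "simple_parry_subst d \<alpha> \<phi>"
    show thesis
      by (rule that[OF parry_simple[OF simple]]) (use simple in \<open>simp add: simple_parry_subst_def\<close>)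
  next
    fix m p assume ns: "d = m + p" "nonsimple_parry_subst m p \<alpha> \<phi>"
    show thesis
      using that[of "\<lambda>i. \<alpha> (if i < m then i else m + (i - m) mod p)"
          "\<lambda>i. [if i < m then i else m + (i - m) mod p]"] parry_nonsimple[OF ns(2)] ns
      by (simp add: nonsimple_parry_subst_def)
  qed
  have "c \<le> real (nat \<lceil>c\<rceil>)" by linarith
  then have "balanced d (real (nat \<lceil>c\<rceil>)) u"
    using assms(5) unfolding balanced_def by (meson order_trans)
  then interpret parry_word d \<phi> t w u "nat \<lceil>c\<rceil>"
    using parry assms(2) by (simp add: parry_word_def parry_word_axioms_def)
  show ?thesis using automatic_abelian_complexity[of U] assms(3) by (simp add: t_alpha)
qed

end
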